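(* Let $X$ be a normal complex projective variety of dimension $n\ge1$ with klt singularities and $-K_X$ big. Let $\tilde\alpha$ be defined with respect to $L=-K_X$ by $$\tilde\alpha:=\inf_{v\in\mathrm{Val}_X^{\mathrm{div}}}\frac{A(v)}{\mathcal S_0(v)+\sigma(v)/n}.$$ Then: (i) if $\tilde\alpha>\frac{n}{n+1}$, then $X$ is K-stable, i.e., $\delta(-K_X)>1$; (ii) if $\tilde\alpha\ge\frac{n}{n+1}$, then $X$ is K-semistable, i.e., $\delta(-K_X)\ge1$.
   Context: A divisor $F$ over $X$ is a prime divisor on a normal variety $Y$ equipped with a proper birational morphism $\pi:Y\to X$; $\mathrm{ord}_F$ is the vanishing order along $F$. A divisorial valuation is $v=C\,\mathrm{ord}_F$ with $C>0$ and $F$ over $X$; $\mathrm{Val}_X^{\mathrm{div}}$ is the set of all of them. For a section $s$ of a line bundle on $X$, $v(s)=C\,\mathrm{ord}_F(\pi^*s)$. The log discrepancy is $A(C\,\mathrm{ord}_F)=C\,(1+\mathrm{ord}_F(K_Y-\pi^*K_X))$. Let $L=-K_X$ and $R_k=H^0(X,kL)$, with $k\ge 1$ ranging over integers such that $kK_X$ is Cartier. The minimal vanishing order is $\sigma(v)=\inf_k\inf_{0\ne s\in R_k}v(s)/k$ and the maximal vanishing order is $\mathcal S_0(v)=\sup_k\sup_{0\ne s\in R_k}v(s)/k$. For $v=\mathrm{ord}_F$, let $\Delta\subset\mathbb R^n$ be the Okounkov body of $L$ associated with an admissible flag on $Y$ whose divisorial member is $F$ (a chain $Y\supset F=Y_1\supset\dots\supset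 Y_n=\{pt\}$ of irreducible subvarieties with $\operatorname{codim}Y_i=i$, all smooth at the point $Y_n$): $\Delta$ is the closed convex hull of the vectors $\nu(s)/k$, $0\neq s\in R_k$, where $\nu(s)\in\mathbb Z_{\ge 0}^n$ is the vector of successive vanishing orders of $\pi^*s$ along the flag, whose first coordinate is $\mathrm{ord}_F(\pi^*s)$. With $p:\mathbb R^n\to\mathbb R$ the projection to the first coordinate and $\mathrm{Bc}\,\Delta=\frac1{|\Delta|}\int_\Delta x\,dx$ the barycenter, set $\mathcal S_1(\mathrm{ord}_F)=p(\mathrm{Bc}\,\Delta)$ (independent of the rest of the flag), and $\mathcal S_1(C\,\mathrm{ord}_F)=C\,\mathcal S_1(\mathrm{ord}_F)$. One has $\sigma(\mathrm{ord}_F)=\min_\Delta p$ and $\mathcal S_0(\mathrm{ord}_F)=\max_\Delta p$. Define $\delta(-K_X):=\inf_{v\in\mathrm{Val}_X^{\mathrm{div}}}A(v)/\mathcal S_1(v)$. K-stability (resp. K-semistability) of $X$ with $-K_X$ big is understood in the valuative sense $\delta(-K_X)>1$ (resp. $\delta(-K_X)\ge1$). *)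

theory Defs
  imports
    "HOL-Analysis.Analysis"
    "HOL-Computational_Algebra.Polynomial"
    "HOL-Algebra.Subrings"
    "HOL-Algebra.Ideal_Product"
begin

text \<open>
  Integral separated schemes of finite type over the complex numbers are represented, following
  Zariski and Chevalley, as models of their function field: the field is a type \<open>'a :: field\<close> with
  an embedding \<open>emb\<close> of the complex numbers, and a variety is the set of its local rings, which are
  subrings of \<open>'a\<close>.  A local ring \<open>P\<close> is a scheme-theoretic point, and at the same time the
  irreducible closed subvariety with that generic point.  For points \<open>P\<close>, \<open>Q\<close> of one variety,
  \<open>P \<subseteq> Q\<close> says that \<open>P\<close> lies on the subvariety \<open>Q\<close>; the generic point of the variety is \<open>UNIV\<close>.
\<close>

section \<open>Local rings in a field\<close>

definition ring_on :: "'a::field set \<Rightarrow> 'a ring" where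
  "ring_on A = \<lparr>carrier = A, mult = (*), one = 1, zero = 0, add = (+)\<rparr>"

definition complex_embedding :: "(complex \<Rightarrow> 'a::field) \<Rightarrow> bool" where
  "complex_embedding emb \<longleftrightarrow> emb \<in> ring_hom (ring_on UNIV) (ring_on UNIV)"

definition is_subring :: "'a::field set \<Rightarrow> bool" where
  "is_subring A \<longleftrightarrow> subring A (ring_on UNIV)"

definition adjoin :: "(complex \<Rightarrow> 'a::field) \<Rightarrow> 'a set \<Rightarrow> 'a set" where
  "adjoin emb S = is_subring hull (range emb \<union> S)"

definition maximal_ideal :: "'a::field set \<Rightarrow> 'a set" where
  "maximal_ideal P = P - Units (ring_on P)"

definition local_subring :: "'a::field set \<Rightarrow> bool" where
  "local_subring P \<longleftrightarrow> is_subring P \<and> ideal (maximal_ideal P) (ring_on P)"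

definition dominates :: "'a::field set \<Rightarrow> 'a set \<Rightarrow> bool" where
  "dominates Q P \<longleftrightarrow> P \<subseteq> Q \<and> maximal_ideal P \<subseteq> maximal_ideal Q"

definition valuation_subring :: "'a::field set \<Rightarrow> bool" where
  "valuation_subring V \<longleftrightarrow> is_subring V \<and> (\<forall>x. x \<in> V \<or> inverse x \<in> V)"

definition integrally_closed :: "'a::field set \<Rightarrow> bool" where
  "integrally_closed A \<longleftrightarrow>
     (\<forall>x q. lead_coeff q = 1 \<and> range (Polynomial.coeff q) \<subseteq> A \<and> poly q x = 0 \<longrightarrow> x \<in> A)"

definition localization :: "'a::field set \<Rightarrow> 'a set \<Rightarrow> 'a set" where
  "localization A p = {a / b | a b. a \<in> A \<and> b \<in> A \<and> b \<notin> p}"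

definition ideal_power :: "'a::field set \<Rightarrow> 'a set \<Rightarrow> nat \<Rightarrow> 'a set" where
  "ideal_power P I k = ((ideal_prod (ring_on P) I) ^^ k) P"


section \<open>Varieties and proper birational morphisms\<close>

definition affine_points :: "'a::field set \<Rightarrow> 'a set set" where
  "affine_points A = {localization A p | p. primeideal p (ring_on A)}"

definition separated :: "'a::field set set \<Rightarrow> bool" where
  "separated Y \<longleftrightarrow>
     (\<forall>P\<in>Y. \<forall>Q\<in>Y. (\<exists>R. local_subring R \<and> dominates R P \<and> dominates R Q) \<longrightarrow> P = Q)"

definition variety :: "(complex \<Rightarrow> 'a::field) \<Rightarrow> 'a set set \<Rightarrow> bool" where
  "variety emb Y \<longleftrightarrow> separated Y \<and>
     (\<exists>\<S>. finite \<S> \<and> \<S> \<noteq> {} \<and>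
        (\<forall>S\<in>\<S>. finite S \<and> localization (adjoin emb S) {0} = UNIV) \<and>
        Y = (\<Union>S\<in>\<S>. affine_points (adjoin emb S)))"

text \<open>\<open>S\<close> lists the values of the homogeneous coordinates at the generic point.\<close>

definition projective_variety :: "(complex \<Rightarrow> 'a::field) \<Rightarrow> 'a set set \<Rightarrow> bool" where
  "projective_variety emb X \<longleftrightarrow> variety emb X \<and>
     (\<exists>S. finite S \<and> X = (\<Union>x\<in>S - {0}. affine_points (adjoin emb ((\<lambda>y. y / x) ` S))))"

definition normal_variety :: "'a::field set set \<Rightarrow> bool" where
  "normal_variety X \<longleftrightarrow> (\<forall>P\<in>X. integrally_closed P)"

text \<open>
  A birational morphism identifies the two function fields, so \<open>\<pi> : Y \<rightarrow> X\<close> becomes the relation of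
  domination.  Properness is the valuative criterion.
\<close>

definition proper_birational :: "'a::field set set \<Rightarrow> 'a set set \<Rightarrow> bool" where
  "proper_birational Y X \<longleftrightarrow> (\<forall>P\<in>Y. \<exists>Q\<in>X. dominates P Q) \<and>
     (\<forall>V. valuation_subring V \<longrightarrow> (\<exists>Q\<in>X. dominates V Q) \<longrightarrow> (\<exists>P\<in>Y. dominates V P))"

definition image_point :: "'a::field set set \<Rightarrow> 'a set \<Rightarrow> 'a set" where
  "image_point X P = (THE Q. Q \<in> X \<and> dominates P Q)"

definition krull_dim :: "'a set set \<Rightarrow> enat" where
  "krull_dim Y = (SUP C\<in>{C. finite C \<and> C \<noteq> {} \<and> subset.chain Y C}. enat (card C - 1))"

definition codim :: "'a::field set set \<Rightarrow> 'a set \<Rightarrow> enat" where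
  "codim Y P = krull_dim {Q\<in>Y. P \<subseteq> Q}"

definition prime_divisors :: "'a::field set set \<Rightarrow> 'a set set" where
  "prime_divisors Y = {P\<in>Y. codim Y P = 1}"

text \<open>
  The local ring of the subvariety \<open>Z\<close> at its point \<open>P\<close> is \<open>P / (maximal_ideal Z \<inter> P)\<close>.
\<close>

definition smooth_at :: "'a::field set set \<Rightarrow> 'a set \<Rightarrow> 'a set \<Rightarrow> bool" where
  "smooth_at Y Z P \<longleftrightarrow>
     (\<exists>S. finite S \<and> S \<subseteq> P \<and> enat (card S) = krull_dim {W\<in>Y. P \<subseteq> W \<and> W \<subseteq> Z} \<and>
        maximal_ideal P = genideal (ring_on P) (S \<union> (maximal_ideal Z \<inter> P)))"


section \<open>Vanishing orders\<close>

text \<open>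
  The order of vanishing along \<open>P\<close> of the restriction to \<open>Z\<close> of a germ \<open>f \<in> P\<close>, where \<open>P\<close> is of
  codimension one in \<open>Z\<close>.  For \<open>Z = UNIV\<close> there is no restriction.
\<close>

definition vanishing_order :: "'a::field set \<Rightarrow> 'a set \<Rightarrow> 'a \<Rightarrow> nat" where
  "vanishing_order Z P f =
     (GREATEST k. \<exists>a\<in>ideal_power P (maximal_ideal P) k. f - a \<in> maximal_ideal Z)"

text \<open>
  For a prime divisor \<open>P\<close> on a normal variety, \<open>P\<close> is a valuation ring, so that \<open>f \<in> P\<close> or
  \<open>inverse f \<in> P\<close>.  The value at \<open>0\<close> is irrelevant.
\<close>

definition ord_at :: "'a::field set \<Rightarrow> 'a \<Rightarrow> int" where
  "ord_at P f = (if f \<in> P then int (vanishing_order UNIV P f)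
              else - int (vanishing_order UNIV P (inverse f)))"


section \<open>Canonical divisor\<close>

definition derivation :: "(complex \<Rightarrow> 'a::field) \<Rightarrow> ('a \<Rightarrow> 'a) \<Rightarrow> bool" where
  "derivation emb D \<longleftrightarrow> (\<forall>x y. D (x + y) = D x + D y) \<and>
     (\<forall>x y. D (x * y) = x * D y + y * D x) \<and> (\<forall>c. D (emb c) = 0)"

text \<open>
  Rational \<open>n\<close>-forms, with \<open>n = CARD('n)\<close>, are regarded as functions on \<open>n\<close>-tuples of derivations
  (set to \<open>0\<close> on other arguments); \<open>dwedge emb x\<close> is \<open>dx\<^sub>1 \<and> \<dots> \<and> dx\<^sub>n\<close>.
\<close>

definition dwedge :: "(complex \<Rightarrow> 'a::field) \<Rightarrow> ('n::finite \<Rightarrow> 'a) \<Rightarrow> ('n \<Rightarrow> 'a \<Rightarrow> 'a) \<Rightarrow> 'a" where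
  "dwedge emb x D = (if \<forall>j. derivation emb (D j) then det (\<chi> i j. D j (x i)) else 0)"

definition rational_form :: "(complex \<Rightarrow> 'a::field) \<Rightarrow> (('n::finite \<Rightarrow> 'a \<Rightarrow> 'a) \<Rightarrow> 'a) \<Rightarrow> bool" where
  "rational_form emb \<omega> \<longleftrightarrow> (\<exists>g x. \<omega> = (\<lambda>D. g * dwedge emb x D))"

text \<open>
  At a prime divisor \<open>P\<close> of a normal variety the module of regular \<open>n\<close>-forms is generated over \<open>P\<close>
  by some \<open>dx\<^sub>1 \<and> \<dots> \<and> dx\<^sub>n\<close> with all \<open>x\<^sub>i \<in> P\<close>.
\<close>

definition ord_form ::
  "(complex \<Rightarrow> 'a::field) \<Rightarrow> (('n::finite \<Rightarrow> 'a \<Rightarrow> 'a) \<Rightarrow> 'a) \<Rightarrow> 'a set \<Rightarrow> int" where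
  "ord_form emb \<omega> P = (THE m. \<exists>g x. range x \<subseteq> P \<and>
     (\<forall>y. range y \<subseteq> P \<longrightarrow> (\<exists>h\<in>P. dwedge emb y = (\<lambda>D. h * dwedge emb x D))) \<and>
     \<omega> = (\<lambda>D. g * dwedge emb x D) \<and> m = ord_at P g)"

text \<open>
  \<open>\<gamma>\<close> is a Cartier divisor with associated Weil divisor \<open>D\<close>: a system of local equations, any two
  of which differ by a unit where both are defined.
\<close>

definition cartier_equations :: "'a::field set set \<Rightarrow> ('a set \<Rightarrow> int) \<Rightarrow> ('a set \<Rightarrow> 'a) \<Rightarrow> bool" where
  "cartier_equations X D \<gamma> \<longleftrightarrow> (\<forall>P\<in>X. \<gamma> P \<noteq> 0 \<and>
     (\<forall>Q\<in>prime_divisors X. P \<subseteq> Q \<longrightarrow> ord_at Q (\<gamma> P) = D Q) \<and>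
     (\<forall>Q\<in>X. P \<subseteq> Q \<longrightarrow> \<gamma> P / \<gamma> Q \<in> Units (ring_on Q)))"

text \<open>\<open>K\<^sub>X\<close> is the divisor of the rational form \<open>\<omega>\<close>.\<close>

definition canonical_cartier ::
  "(complex \<Rightarrow> 'a::field) \<Rightarrow> 'a set set \<Rightarrow> (('n::finite \<Rightarrow> 'a \<Rightarrow> 'a) \<Rightarrow> 'a) \<Rightarrow> nat \<Rightarrow> bool" where
  "canonical_cartier emb X \<omega> k \<longleftrightarrow>
     1 \<le> k \<and> (\<exists>\<gamma>. cartier_equations X (\<lambda>Q. int k * ord_form emb \<omega> Q) \<gamma>)"

definition canonical_equations ::
  "(complex \<Rightarrow> 'a::field) \<Rightarrow> 'a set set \<Rightarrow> (('n::finite \<Rightarrow> 'a \<Rightarrow> 'a) \<Rightarrow> 'a) \<Rightarrow> nat \<Rightarrow> 'a set \<Rightarrow> 'a" where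
  "canonical_equations emb X \<omega> k =
     (SOME \<gamma>. cartier_equations X (\<lambda>Q. int k * ord_form emb \<omega> Q) \<gamma>)"


section \<open>Anticanonical sections\<close>

text \<open>
  \<open>R\<^sub>k = H\<^sup>0(X, -k K\<^sub>X)\<close> as a space of rational functions; near \<open>P\<close> the line bundle is generated by
  the local equation \<open>\<gamma> P\<close> of \<open>k K\<^sub>X\<close>, so the section \<open>s\<close> corresponds there to the regular function
  \<open>s / \<gamma> P\<close>.
\<close>

definition sections ::
  "(complex \<Rightarrow> 'a::field) \<Rightarrow> 'a set set \<Rightarrow> (('n::finite \<Rightarrow> 'a \<Rightarrow> 'a) \<Rightarrow> 'a) \<Rightarrow> nat \<Rightarrow> 'a set" where
  "sections emb X \<omega> k = {s. \<forall>P\<in>X. s / canonical_equations emb X \<omega> k P \<in> P}"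

definition anticanonical_volume ::
  "(complex \<Rightarrow> 'a::field) \<Rightarrow> 'a set set \<Rightarrow> (('n::finite \<Rightarrow> 'a \<Rightarrow> 'a) \<Rightarrow> 'a) \<Rightarrow> ereal" where
  "anticanonical_volume emb X \<omega> =
     Limsup (inf sequentially (principal {k. canonical_cartier emb X \<omega> k}))
       (\<lambda>k. ereal (real (vector_space.dim (\<lambda>c x. emb c * x) (sections emb X \<omega> k))
                    / (real k ^ CARD('n) / fact CARD('n))))"

definition anticanonical_big ::
  "(complex \<Rightarrow> 'a::field) \<Rightarrow> 'a set set \<Rightarrow> (('n::finite \<Rightarrow> 'a \<Rightarrow> 'a) \<Rightarrow> 'a) \<Rightarrow> bool" where
  "anticanonical_big emb X \<omega> \<longleftrightarrow> anticanonical_volume emb X \<omega> > 0"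

text \<open>The germ at the point \<open>P\<close> of \<open>Y\<close> of the pullback of \<open>s\<close> to \<open>Y\<close>.\<close>

definition pullback_germ ::
  "(complex \<Rightarrow> 'a::field) \<Rightarrow> 'a set set \<Rightarrow> (('n::finite \<Rightarrow> 'a \<Rightarrow> 'a) \<Rightarrow> 'a) \<Rightarrow> 'a set \<Rightarrow> nat \<Rightarrow> 'a \<Rightarrow> 'a" where
  "pullback_germ emb X \<omega> P k s = s / canonical_equations emb X \<omega> k (image_point X P)"

definition ord_section ::
  "(complex \<Rightarrow> 'a::field) \<Rightarrow> 'a set set \<Rightarrow> (('n::finite \<Rightarrow> 'a \<Rightarrow> 'a) \<Rightarrow> 'a) \<Rightarrow> 'a set \<Rightarrow> nat \<Rightarrow> 'a \<Rightarrow> int" where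
  "ord_section emb X \<omega> F k s = ord_at F (pullback_germ emb X \<omega> F k s)"


section \<open>Divisorial valuations and log discrepancy\<close>

definition divisor_over :: "(complex \<Rightarrow> 'a::field) \<Rightarrow> 'a set set \<Rightarrow> 'a set set \<Rightarrow> 'a set \<Rightarrow> bool" where
  "divisor_over emb X Y F \<longleftrightarrow>
     variety emb Y \<and> normal_variety Y \<and> proper_birational Y X \<and> F \<in> prime_divisors Y"

definition scaled_ord :: "real \<Rightarrow> 'a::field set \<Rightarrow> 'a \<Rightarrow> ereal" where
  "scaled_ord C F f = (if f = 0 then \<infinity> else ereal (C * real_of_int (ord_at F f)))"

definition Val_div :: "(complex \<Rightarrow> 'a::field) \<Rightarrow> 'a set set \<Rightarrow> ('a \<Rightarrow> ereal) set" where
  "Val_div emb X = {scaled_ord C F | C Y F. C > 0 \<and> divisor_over emb X Y F}"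

text \<open>
  The invariants of \<open>v\<close> below are given in terms of a presentation \<open>v = C ord\<^sub>F\<close> with \<open>F\<close> on \<open>Y\<close>, on
  which they do not depend.
\<close>

definition presentation ::
  "(complex \<Rightarrow> 'a::field) \<Rightarrow> 'a set set \<Rightarrow> ('a \<Rightarrow> ereal) \<Rightarrow> real \<times> 'a set set \<times> 'a set" where
  "presentation emb X v = (SOME (C, Y, F). C > 0 \<and> divisor_over emb X Y F \<and> v = scaled_ord C F)"

text \<open>
  \<open>ord\<^sub>F (K\<^sub>Y - \<pi>\<^sup>* K\<^sub>X)\<close>, where \<open>K\<^sub>Y\<close> is the divisor of \<open>\<omega>\<close> on \<open>Y\<close>, \<open>m\<close> is the Cartier index of
  \<open>K\<^sub>X\<close> and \<open>\<pi>\<^sup>* K\<^sub>X = (1/m) \<pi>\<^sup>* (m K\<^sub>X)\<close>.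
\<close>

definition discrepancy ::
  "(complex \<Rightarrow> 'a::field) \<Rightarrow> 'a set set \<Rightarrow> (('n::finite \<Rightarrow> 'a \<Rightarrow> 'a) \<Rightarrow> 'a) \<Rightarrow> 'a set \<Rightarrow> real" where
  "discrepancy emb X \<omega> F =
     (let m = (LEAST m. canonical_cartier emb X \<omega> m)
      in real_of_int (ord_form emb \<omega> F) -
         real_of_int (ord_at F (canonical_equations emb X \<omega> m (image_point X F))) / real m)"

definition log_discrepancy ::
  "(complex \<Rightarrow> 'a::field) \<Rightarrow> 'a set set \<Rightarrow> (('n::finite \<Rightarrow> 'a \<Rightarrow> 'a) \<Rightarrow> 'a) \<Rightarrow> ('a \<Rightarrow> ereal) \<Rightarrow> real" where
  "log_discrepancy emb X \<omega> v =
     (case presentation emb X v of (C, Y, F) \<Rightarrow> C * (1 + discrepancy emb X \<omega> F))"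

definition klt ::
  "(complex \<Rightarrow> 'a::field) \<Rightarrow> 'a set set \<Rightarrow> (('n::finite \<Rightarrow> 'a \<Rightarrow> 'a) \<Rightarrow> 'a) \<Rightarrow> bool" where
  "klt emb X \<omega> \<longleftrightarrow> normal_variety X \<and> (\<exists>m. canonical_cartier emb X \<omega> m) \<and>
     (\<forall>Y F. divisor_over emb X Y F \<longrightarrow> discrepancy emb X \<omega> F > - 1)"

definition val_section ::
  "(complex \<Rightarrow> 'a::field) \<Rightarrow> 'a set set \<Rightarrow> (('n::finite \<Rightarrow> 'a \<Rightarrow> 'a) \<Rightarrow> 'a) \<Rightarrow> ('a \<Rightarrow> ereal) \<Rightarrow> nat \<Rightarrow> 'a \<Rightarrow> real" where
  "val_section emb X \<omega> v k s =
     (case presentation emb X v of (C, Y, F) \<Rightarrow> C * real_of_int (ord_section emb X \<omega> F k s))"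

definition sigma_min ::
  "(complex \<Rightarrow> 'a::field) \<Rightarrow> 'a set set \<Rightarrow> (('n::finite \<Rightarrow> 'a \<Rightarrow> 'a) \<Rightarrow> 'a) \<Rightarrow> ('a \<Rightarrow> ereal) \<Rightarrow> ereal" where
  "sigma_min emb X \<omega> v = (INF k\<in>{k. canonical_cartier emb X \<omega> k}.
     INF s\<in>sections emb X \<omega> k - {0}. ereal (val_section emb X \<omega> v k s / real k))"

definition S0 ::
  "(complex \<Rightarrow> 'a::field) \<Rightarrow> 'a set set \<Rightarrow> (('n::finite \<Rightarrow> 'a \<Rightarrow> 'a) \<Rightarrow> 'a) \<Rightarrow> ('a \<Rightarrow> ereal) \<Rightarrow> ereal" where
  "S0 emb X \<omega> v = (SUP k\<in>{k. canonical_cartier emb X \<omega> k}.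
     SUP s\<in>sections emb X \<omega> k - {0}. ereal (val_section emb X \<omega> v k s / real k))"


section \<open>Okounkov bodies\<close>

definition admissible_flag :: "'a::field set set \<Rightarrow> 'a set \<Rightarrow> nat \<Rightarrow> (nat \<Rightarrow> 'a set) \<Rightarrow> bool" where
  "admissible_flag Y F n fl \<longleftrightarrow> fl 0 = UNIV \<and> fl 1 = F \<and>
     (\<forall>i\<le>n. fl i \<in> Y \<and> codim Y (fl i) = enat i \<and> smooth_at Y (fl i) (fl n)) \<and>
     (\<forall>i<n. fl (Suc i) \<subseteq> fl i)"

text \<open>An equation at the point \<open>P\<close> of the divisor \<open>W\<close> in the subvariety \<open>Z\<close>.\<close>

definition flag_equation :: "'a::field set \<Rightarrow> 'a set \<Rightarrow> 'a set \<Rightarrow> 'a" where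
  "flag_equation P Z W = (SOME t. t \<in> P \<and>
     maximal_ideal W \<inter> P = genideal (ring_on P) (insert t (maximal_ideal Z \<inter> P)))"

text \<open>
  Germs at the point \<open>P\<close> of the flag: the restriction to \<open>Y\<^sub>i\<close> of \<open>flag_germ P fl f i\<close> is divided by
  the highest possible power of an equation of \<open>Y\<^sub>i\<^sub>+\<^sub>1\<close> in \<open>Y\<^sub>i\<close>; the quotient is lifted to \<open>P\<close> and is
  next restricted to \<open>Y\<^sub>i\<^sub>+\<^sub>1\<close>.
\<close>

primrec flag_germ :: "'a::field set \<Rightarrow> (nat \<Rightarrow> 'a set) \<Rightarrow> 'a \<Rightarrow> nat \<Rightarrow> 'a" where
  "flag_germ P fl f 0 = f"
| "flag_germ P fl f (Suc i) =
     (SOME h. h \<in> P \<and>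
        flag_germ P fl f i -
        flag_equation P (fl i) (fl (Suc i)) ^ vanishing_order (fl i) (fl (Suc i)) (flag_germ P fl f i) * h
        \<in> maximal_ideal (fl i))"

text \<open>
  Coordinates are numbered from \<open>0\<close>.  Coordinate \<open>0\<close> is the vanishing order along \<open>F\<close>, read off at
  the generic point of \<open>F\<close> rather than at the point of the flag.
\<close>

definition flag_orders ::
  "(complex \<Rightarrow> 'a::field) \<Rightarrow> 'a set set \<Rightarrow> (('n::finite \<Rightarrow> 'a \<Rightarrow> 'a) \<Rightarrow> 'a) \<Rightarrow> 'a set \<Rightarrow> (nat \<Rightarrow> 'a set) \<Rightarrow>
     nat \<Rightarrow> 'a \<Rightarrow> nat \<Rightarrow> int" where
  "flag_orders emb X \<omega> F fl k s i =
     (if i = 0 then ord_section emb X \<omega> F k s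
      else (let P = fl CARD('n)
            in int (vanishing_order (fl i) (fl (Suc i))
                      (flag_germ P fl (pullback_germ emb X \<omega> P k s) i))))"

text \<open>The linear order on the index type lists the coordinates; \<open>card {..<i}\<close> is the rank of \<open>i\<close>.\<close>

definition okounkov_body ::
  "(complex \<Rightarrow> 'a::field) \<Rightarrow> 'a set set \<Rightarrow> (('n::{finite,linorder} \<Rightarrow> 'a \<Rightarrow> 'a) \<Rightarrow> 'a) \<Rightarrow> 'a set \<Rightarrow>
     (nat \<Rightarrow> 'a set) \<Rightarrow> (real ^ 'n::{finite,linorder}) set" where
  "okounkov_body emb X \<omega> F fl =
     closure (convex hull
       {(1 / real k) *\<^sub>R (\<chi> i. real_of_int (flag_orders emb X \<omega> F fl k s (card {..<i}))) | k s.
          canonical_cartier emb X \<omega> k \<and> s \<in> sections emb X \<omega> k \<and> s \<noteq> 0})"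

definition barycenter :: "(real ^ 'n) set \<Rightarrow> real ^ 'n" where
  "barycenter \<Delta> = (1 / measure lborel \<Delta>) *\<^sub>R (LINT x:\<Delta>|lborel. x)"

definition first_coordinate :: "real ^ 'n::{finite,linorder} \<Rightarrow> real" where
  "first_coordinate x = x $ Min UNIV"

definition S1 ::
  "(complex \<Rightarrow> 'a::field) \<Rightarrow> 'a set set \<Rightarrow> (('n::{finite,linorder} \<Rightarrow> 'a \<Rightarrow> 'a) \<Rightarrow> 'a) \<Rightarrow> ('a \<Rightarrow> ereal) \<Rightarrow> real" where
  "S1 emb X \<omega> v =
     (case presentation emb X v of (C, Y, F) \<Rightarrow>
        C * first_coordinate (barycenter
              (okounkov_body emb X \<omega> F (SOME fl. admissible_flag Y F CARD('n) fl))))"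


section \<open>Thresholds and K-stability\<close>

definition delta ::
  "(complex \<Rightarrow> 'a::field) \<Rightarrow> 'a set set \<Rightarrow> (('n::{finite,linorder} \<Rightarrow> 'a \<Rightarrow> 'a) \<Rightarrow> 'a) \<Rightarrow> ereal" where
  "delta emb X \<omega> = (INF v\<in>Val_div emb X. ereal (log_discrepancy emb X \<omega> v) / ereal (S1 emb X \<omega> v))"

definition alpha_tilde ::
  "(complex \<Rightarrow> 'a::field) \<Rightarrow> 'a set set \<Rightarrow> (('n::finite \<Rightarrow> 'a \<Rightarrow> 'a) \<Rightarrow> 'a) \<Rightarrow> ereal" where
  "alpha_tilde emb X \<omega> = (INF v\<in>Val_div emb X.
     ereal (log_discrepancy emb X \<omega> v) /
     (S0 emb X \<omega> v + sigma_min emb X \<omega> v / ereal (real CARD('n))))"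

definition K_stable ::
  "(complex \<Rightarrow> 'a::field) \<Rightarrow> 'a set set \<Rightarrow> (('n::{finite,linorder} \<Rightarrow> 'a \<Rightarrow> 'a) \<Rightarrow> 'a) \<Rightarrow> bool" where
  "K_stable emb X \<omega> \<longleftrightarrow> delta emb X \<omega> > 1"

definition K_semistable ::
  "(complex \<Rightarrow> 'a::field) \<Rightarrow> 'a set set \<Rightarrow> (('n::{finite,linorder} \<Rightarrow> 'a \<Rightarrow> 'a) \<Rightarrow> 'a) \<Rightarrow> bool" where
  "K_semistable emb X \<omega> \<longleftrightarrow> delta emb X \<omega> \<ge> 1"

end

theory Submission
  imports Defs
begin

text \<open>
  Write \<open>p\<close> for the first coordinate on the Okounkov body \<open>\<Delta>\<close> and \<open>M = max p\<close>.  Applied to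
  \<open>f = M - p\<close>, the bound \<open>f x0 |\<Delta>| \<le> (n + 1) \<integral> f\<close>, valid for nonnegative concave \<open>f\<close> on a
  convex set, says that \<open>(n + 1) p (Bc \<Delta>) \<le> n M + p x0\<close> for every \<open>x0 \<in> \<Delta>\<close>.  Taking the infimum over
  the points \<open>x0\<close> defined by sections gives \<open>S1 \<le> n/(n+1) (S0 + sigma/n)\<close>, hence
  \<open>delta \<ge> (n+1)/n alpha_tilde\<close>.
\<close>

section \<open>Concave functions: value at a point against the integral\<close>

text \<open>
  Contract \<open>S\<close> towards \<open>x0\<close> by the factor \<open>t\<close>.  By concavity the integral \<open>J\<close> of \<open>f\<close> over the image is
  at least \<open>t^n ((1 - t) f x0 |S| + t J)\<close>, and it is at most \<open>J\<close>; divide by \<open>1 - t\<close> and let \<open>t \<rightarrow> 1\<close>.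
\<close>

lemma concave_value_le_integral:
  fixes f :: "'a::euclidean_space \<Rightarrow> real"
  assumes conc: "concave_on S f" and nonneg: "\<And>x. x \<in> S \<Longrightarrow> 0 \<le> f x"
    and S: "S \<in> sets borel" "emeasure lborel S < \<infinity>"
    and int: "set_integrable lborel S f" and x0: "x0 \<in> S"
  shows "f x0 * measure lborel S \<le> (real DIM('a) + 1) * (LINT x:S|lborel. f x)"
proof -
  define n where "n = DIM('a)"
  define J where "J = (LINT x:S|lborel. f x)"
  define F where "F = f x0 * measure lborel S"
  define g where "g = (\<lambda>x. indicator S x *\<^sub>R f x)"
  have g_int: "integrable lborel g"
    using int by (simp add: g_def set_integrable_def)
  then have g_meas [measurable]: "g \<in> borel_measurable borel"
    by (auto dest: borel_measurable_integrable)
  have J_g: "J = integral\<^sup>L lborel g"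
    by (simp add: J_def g_def set_lebesgue_integral_def)
  have conv: "convex S"
    using conc by (simp add: concave_on_def convex_on_def)
  \<comment> \<open>The sum is the geometric series \<open>(1 - t ^ Suc n) / (1 - t)\<close>: the
    factor \<open>1 - t\<close> is cancelled here, so the limit below involves no quotient. The
    exponent \<open>Suc n\<close> arises from moving \<open>t ^ n * (t * J)\<close> to the
    right.\<close>
  have step: "t ^ n * F \<le> J * (\<Sum>i\<le>n. t ^ i)" if t: "0 < t" "t < 1" for t
  proof -
    define T where "T = (\<lambda>x::'a. (1 - t) *\<^sub>R x0 + t *\<^sub>R x)"
    have [measurable]: "T \<in> borel_measurable borel"
      by (simp add: T_def)
    have lb: "lborel = density (distr lborel borel T) (\<lambda>_. ennreal (t ^ n))"
      using lborel_affine[of t "(1 - t) *\<^sub>R x0"] t by (simp add: T_def n_def)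
    have "integrable (density (distr lborel borel T) (\<lambda>_. ennreal (t ^ n))) g"
      using g_int lb by simp
    then have gT_int: "integrable lborel (\<lambda>x. g (T x))"
      using t by (simp add: integrable_density integrable_distr_eq)
    \<comment> \<open>Changing variables over the whole space loses nothing, so this is an equality.
      The fact that \<open>T\<close> maps \<open>S\<close> into \<open>S\<close>, possibly not onto
      it, enters only in the pointwise estimate.\<close>
    have "J = integral\<^sup>L (density (distr lborel borel T) (\<lambda>_. ennreal (t ^ n))) g"
      unfolding J_g using lb by simp
    also have "\<dots> = t ^ n * (\<integral>x. g (T x) \<partial>lborel)"
      using t by (simp add: integral_density integral_distr)
    finally have J_T: "J = t ^ n * (\<integral>x. g (T x) \<partial>lborel)" .
    have ind_int: "integrable lborel (indicat_real S)"
      using S by simp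
    have "(1 - t) * F + t * J
        = (\<integral>x. (1 - t) * f x0 * indicat_real S x + t * g x \<partial>lborel)"
      using g_int ind_int S by (simp add: F_def J_g)
    also have "\<dots> \<le> (\<integral>x. g (T x) \<partial>lborel)"
    proof (rule integral_mono)
      show "integrable lborel (\<lambda>x. (1 - t) * f x0 * indicat_real S x + t * g x)"
        using g_int ind_int by simp
      show "integrable lborel (\<lambda>x. g (T x))" by (rule gT_int)
      fix x
      show "(1 - t) * f x0 * indicat_real S x + t * g x \<le> g (T x)"
      proof (cases "x \<in> S")
        case True
        then have "T x \<in> S"
          using conv x0 t by (simp add: T_def convex_alt)
        moreover have "(1 - t) * f x0 + t * f x \<le> f (T x)"
          using conc True x0 t by (simp add: T_def concave_on_iff)
        ultimately show ?thesis
          using True by (simp add: g_def)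
      next
        \<comment> \<open>The left side vanishes, while \<open>T x\<close> may still lie in
          \<open>S\<close>; nonnegativity of \<open>f\<close> gives the inequality.\<close>
        case False
        then show ?thesis
          using nonneg by (simp add: g_def indicator_def)
      qed
    qed
    finally have "t ^ n * ((1 - t) * F + t * J) \<le> t ^ n * (\<integral>x. g (T x) \<partial>lborel)"
      using t by (intro mult_left_mono) auto
    also have "\<dots> = J"
      using J_T by simp
    finally have "t ^ n * ((1 - t) * F + t * J) \<le> J" .
    then have "(1 - t) * (t ^ n * F) \<le> J * (1 - t ^ Suc n)"
      by (simp add: algebra_simps)
    also have "\<dots> = (1 - t) * (J * (\<Sum>i\<le>n. t ^ i))"
      by (simp add: one_diff_power_eq' [of t "Suc n"] sum_gp_basic lessThan_Suc_atMost)
    finally show ?thesis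
      using t by simp
  qed
  \<comment> \<open>Let \<open>t\<close> tend to 1 from the left in \<open>step\<close>. The
    \<open>n + 1\<close> terms of the sum each tend to 1, whence the factor.\<close>
  have "F \<le> J * real (Suc n)"
  proof (rule tendsto_le)
    show "((\<lambda>t. t ^ n * F) \<longlongrightarrow> F) (at_left (1::real))"
      by (auto intro!: tendsto_eq_intros)
    show "((\<lambda>t. J * (\<Sum>i\<le>n. t ^ i)) \<longlongrightarrow> J * real (Suc n)) (at_left (1::real))"
      by (auto intro!: tendsto_eq_intros)
    show "eventually (\<lambda>t. t ^ n * F \<le> J * (\<Sum>i\<le>n. t ^ i)) (at_left (1::real))"
      using eventually_at_left_real[OF zero_less_one] by eventually_elim (use step in auto)
  qed simp
  then show ?thesis
    by (simp add: F_def J_def n_def mult.commute add.commute)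
qed

section \<open>Subrings, ideals and localizations in a field\<close>

lemma cring_ring_on_UNIV: "cring (ring_on (UNIV :: 'a::field set))"
proof (rule cringI)
  show "abelian_group (ring_on (UNIV :: 'a set))"
  proof (rule abelian_groupI)
    fix x :: 'a
    show "\<exists>y\<in>carrier (ring_on UNIV). y \<oplus>\<^bsub>ring_on UNIV\<^esub> x = \<zero>\<^bsub>ring_on UNIV\<^esub>"
      by (rule bexI[of _ "- x"]) (auto simp: ring_on_def)
  qed (auto simp: ring_on_def)
  show "Group.comm_monoid (ring_on (UNIV :: 'a set))"
    by (rule comm_monoidI) (auto simp: ring_on_def)
qed (auto simp: ring_on_def algebra_simps)

lemma a_inv_ring_on: "\<ominus>\<^bsub>ring_on UNIV\<^esub> x = - x"
proof -
  interpret cring "ring_on (UNIV :: 'a set)" by (rule cring_ring_on_UNIV)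
  show ?thesis
    by (rule minus_equality) (auto simp: ring_on_def)
qed

text \<open>Replaces the HOL-Algebra predicate by closure under the operations of the field itself,
  so that later arguments are plain field arithmetic.\<close>

lemma is_subring_iff:
  "is_subring A \<longleftrightarrow> 1 \<in> A \<and> (\<forall>x\<in>A. - x \<in> A) \<and> (\<forall>x\<in>A. \<forall>y\<in>A. x + y \<in> A \<and> x * y \<in> A)"
proof -
  interpret cring "ring_on (UNIV :: 'a set)" by (rule cring_ring_on_UNIV)
  have simps: "carrier (ring_on B) = B" "mult (ring_on B) = (*)" "add (ring_on B) = (+)"
    "one (ring_on B) = 1" for B :: "'a set"
    by (auto simp: ring_on_def)
  show ?thesis
  proof
    assume "is_subring A"
    then have A: "subring A (ring_on UNIV)" by (simp add: is_subring_def)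
    show "1 \<in> A \<and> (\<forall>x\<in>A. - x \<in> A) \<and> (\<forall>x\<in>A. \<forall>y\<in>A. x + y \<in> A \<and> x * y \<in> A)"
      using subringE[OF A] by (simp add: simps a_inv_ring_on)
  next
    assume "1 \<in> A \<and> (\<forall>x\<in>A. - x \<in> A) \<and> (\<forall>x\<in>A. \<forall>y\<in>A. x + y \<in> A \<and> x * y \<in> A)"
    then show "is_subring A"
      unfolding is_subring_def by (intro subringI) (auto simp: simps a_inv_ring_on)
  qed
qed

lemma is_subring_zero: "is_subring A \<Longrightarrow> 0 \<in> A"
  unfolding is_subring_iff by (metis add.right_inverse)

lemma is_subring_adjoin: "is_subring (adjoin emb S)"
  unfolding adjoin_def hull_def by (auto simp: is_subring_iff)

lemma ring_ring_on: assumes "is_subring A" shows "ring (ring_on A)"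
proof -
  interpret cring "ring_on (UNIV :: 'a set)" by (rule cring_ring_on_UNIV)
  have "ring (ring_on UNIV \<lparr>carrier := A\<rparr>)"
    using assms by (simp add: is_subring_def subring_is_ring)
  then show ?thesis by (simp add: ring_on_def)
qed

text \<open>Negatives come from \<open>- x = - 1 * x\<close> with \<open>- 1 \<in> A\<close>, and
  commutativity of the field makes a left ideal two-sided.\<close>

lemma ideal_ring_on_iff:
  assumes A: "is_subring A"
  shows "ideal I (ring_on A) \<longleftrightarrow>
    I \<subseteq> A \<and> 0 \<in> I \<and> (\<forall>x\<in>I. \<forall>y\<in>I. x + y \<in> I) \<and> (\<forall>a\<in>A. \<forall>x\<in>I. a * x \<in> I)"
    (is "_ \<longleftrightarrow> ?R")
proof
  assume "ideal I (ring_on A)"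
  then interpret ideal I "ring_on A" .
  show ?R
  proof (intro conjI ballI)
    show "I \<subseteq> A" using a_subset by (simp add: ring_on_def)
    show "0 \<in> I"
      using additive_subgroup.zero_closed[OF is_additive_subgroup] by (simp add: ring_on_def)
    show "x + y \<in> I" if "x \<in> I" "y \<in> I" for x y
      using additive_subgroup.a_closed[OF is_additive_subgroup that] by (simp add: ring_on_def)
    show "a * x \<in> I" if "a \<in> A" "x \<in> I" for a x
      using I_l_closed[of x a] that by (simp add: ring_on_def)
  qed
next
  assume R: ?R
  show "ideal I (ring_on A)"
  proof (rule idealI)
    show "ring (ring_on A)" by (rule ring_ring_on[OF A])
    then interpret ring "ring_on A" .
    have inv: "\<exists>y\<in>I. y + x = 0 \<and> x + y = 0" if "x \<in> I" for x
    proof (rule bexI[of _ "- x"])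
      have "- 1 \<in> A" using A by (auto simp: is_subring_iff)
      then have "- 1 * x \<in> I" using R that by blast
      then show "- x \<in> I" by simp
    qed simp
    show "subgroup I (add_monoid (ring_on A))"
    proof (rule add.subgroupI)
      fix a assume a: "a \<in> I"
      then obtain y where y: "y \<in> I" "y + a = 0" using inv by blast
      then have "\<ominus>\<^bsub>ring_on A\<^esub> a = y"
        by (intro minus_equality) (use R a in \<open>auto simp: ring_on_def\<close>)
      then show "\<ominus>\<^bsub>ring_on A\<^esub> a \<in> I" using y by simp
    qed (use R in \<open>auto simp: ring_on_def\<close>)
    fix a x assume "a \<in> I" "x \<in> carrier (ring_on A)"
    then have "x * a \<in> I" using R by (simp add: ring_on_def)
    then show "x \<otimes>\<^bsub>ring_on A\<^esub> a \<in> I" "a \<otimes>\<^bsub>ring_on A\<^esub> x \<in> I"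
      by (simp_all add: ring_on_def mult.commute)
  qed
qed

lemma maximal_ideal_iff:
  "x \<in> maximal_ideal P \<longleftrightarrow> x \<in> P \<and> (\<forall>y\<in>P. x * y \<noteq> 1)"
  by (auto simp: maximal_ideal_def Units_def ring_on_def mult.commute)

text \<open>The nonunits of the localization are exactly the fractions with numerator in
  \<open>p\<close>: a numerator outside \<open>p\<close> allows inversion, and primality excludes an
  inverse otherwise. These fractions visibly form an ideal.\<close>

lemma local_subring_localization:
  assumes A: "is_subring A" and p: "primeideal p (ring_on A)"
  shows "local_subring (localization A p)"
proof -
  interpret primeideal p "ring_on A" by (rule p)
  have "ideal p (ring_on A)" ..
  then have pI: "p \<subseteq> A" "0 \<in> p" "\<And>x y. x \<in> p \<Longrightarrow> y \<in> p \<Longrightarrow> x + y \<in> p"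
    "\<And>a x. a \<in> A \<Longrightarrow> x \<in> p \<Longrightarrow> a * x \<in> p"
    using ideal_ring_on_iff[OF A] by auto
  have prime: "a * b \<notin> p" if "a \<in> A" "b \<in> A" "a \<notin> p" "b \<notin> p" for a b
    using I_prime[of a b] that by (auto simp: ring_on_def)
  have "1 \<notin> p"
    using pI(4)[of _ 1] I_notcarr pI(1) by (auto simp: ring_on_def)
  have Ac: "1 \<in> A" "\<And>x. x \<in> A \<Longrightarrow> - x \<in> A" "\<And>x y. x \<in> A \<Longrightarrow> y \<in> A \<Longrightarrow> x + y \<in> A"
    "\<And>x y. x \<in> A \<Longrightarrow> y \<in> A \<Longrightarrow> x * y \<in> A"
    using A by (auto simp: is_subring_iff)
  let ?P = "localization A p"
  have mem: "a / b \<in> ?P" if "a \<in> A" "b \<in> A" "b \<notin> p" for a b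
    using that by (auto simp: localization_def)
  \<comment> \<open>Denominators are nonzero because they avoid \<open>p\<close>, which contains
    0.\<close>
  have memE: "\<exists>a b. x = a / b \<and> a \<in> A \<and> b \<in> A \<and> b \<notin> p \<and> b \<noteq> 0" if "x \<in> ?P" for x
    using that pI(2) by (auto simp: localization_def)
  have sub: "is_subring ?P"
    unfolding is_subring_iff
  proof (intro conjI ballI)
    show "1 \<in> ?P" using mem[of 1 1] Ac \<open>1 \<notin> p\<close> by simp
  next
    fix x assume "x \<in> ?P"
    then obtain a b where "x = a / b" "a \<in> A" "b \<in> A" "b \<notin> p" using memE by blast
    then show "- x \<in> ?P" using mem[of "- a" b] Ac by simp
  next
    fix x y assume "x \<in> ?P" "y \<in> ?P"
    then obtain a b c d where *: "x = a / b" "a \<in> A" "b \<in> A" "b \<notin> p" "b \<noteq> 0"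
      "y = c / d" "c \<in> A" "d \<in> A" "d \<notin> p" "d \<noteq> 0" using memE by metis
    then show "x + y \<in> ?P" using mem[of "a * d + c * b" "b * d"] Ac prime
      by (simp add: add_frac_eq)
    show "x * y \<in> ?P" using mem[of "a * c" "b * d"] * Ac prime by simp
  qed
  have max: "maximal_ideal ?P = {a / b | a b. a \<in> p \<and> b \<in> A \<and> b \<notin> p}"
  proof (intro subset_antisym subsetI)
    fix x assume x: "x \<in> maximal_ideal ?P"
    then obtain a b where *: "x = a / b" "a \<in> A" "b \<in> A" "b \<notin> p" "b \<noteq> 0"
      using memE by (metis maximal_ideal_iff)
    have "a \<in> p"
    proof (rule ccontr)
      assume "a \<notin> p"
      then have "b / a \<in> ?P" "a \<noteq> 0" using mem * pI(2) by auto
      then show False using x * by (auto simp: maximal_ideal_iff)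
    qed
    then show "x \<in> {a / b | a b. a \<in> p \<and> b \<in> A \<and> b \<notin> p}" using * by blast
  next
    fix x assume "x \<in> {a / b | a b. a \<in> p \<and> b \<in> A \<and> b \<notin> p}"
    then obtain a b where *: "x = a / b" "a \<in> p" "b \<in> A" "b \<notin> p" by blast
    have "x * y \<noteq> 1" if yP: "y \<in> ?P" for y
    proof
      assume eq: "x * y = 1"
      obtain c d where y: "y = c / d" "c \<in> A" "d \<in> A" "d \<notin> p" "d \<noteq> 0"
        using memE[OF yP] by blast
      have "b \<noteq> 0" using * pI(2) by auto
      then have "c * a = b * d" using eq * y by (simp add: field_simps)
      then show False using prime[of b d] pI(4)[of c a] * y by auto
    qed
    then show "x \<in> maximal_ideal ?P"
      using * mem pI(1) by (auto simp: maximal_ideal_iff)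
  qed
  have "ideal (maximal_ideal ?P) (ring_on ?P)"
    unfolding ideal_ring_on_iff[OF sub]
  proof (intro conjI ballI)
    show "maximal_ideal ?P \<subseteq> ?P" by (auto simp: maximal_ideal_def)
    show "0 \<in> maximal_ideal ?P"
      using is_subring_zero[OF sub] by (auto simp: maximal_ideal_iff)
  next
    fix x y assume "x \<in> maximal_ideal ?P" "y \<in> maximal_ideal ?P"
    then obtain a b c d where *: "x = a / b" "a \<in> p" "b \<in> A" "b \<notin> p"
      "y = c / d" "c \<in> p" "d \<in> A" "d \<notin> p" unfolding max by blast
    then have "b \<noteq> 0" "d \<noteq> 0" using pI(2) by auto
    then have "x + y = (d * a + b * c) / (b * d)" using * by (simp add: add_frac_eq algebra_simps)
    moreover have "d * a + b * c \<in> p" "b * d \<in> A" "b * d \<notin> p"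
      using * pI(3,4) Ac(4) prime by auto
    ultimately show "x + y \<in> maximal_ideal ?P"
      unfolding max by blast
  next
    fix x y assume "x \<in> ?P" "y \<in> maximal_ideal ?P"
    then obtain a b c d where *: "x = a / b" "a \<in> A" "b \<in> A" "b \<notin> p"
      "y = c / d" "c \<in> p" "d \<in> A" "d \<notin> p" unfolding max using memE by blast
    then have "x * y = (a * c) / (b * d)" by simp
    moreover have "a * c \<in> p" "b * d \<in> A" "b * d \<notin> p"
      using * pI(4) Ac(4) prime by auto
    ultimately show "x * y \<in> maximal_ideal ?P"
      unfolding max by blast
  qed
  then show ?thesis using sub by (simp add: local_subring_def)
qed

section \<open>Points of varieties and orders of sections\<close>

lemma local_subring_of_variety: "variety emb Y \<Longrightarrow> P \<in> Y \<Longrightarrow> local_subring P"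
  unfolding variety_def affine_points_def
  using local_subring_localization is_subring_adjoin by blast

text \<open>Existence is part of \<open>proper_birational\<close>. For uniqueness, \<open>P\<close>
  is itself a local ring dominating both candidates, so separatedness of \<open>X\<close> identifies
  them.\<close>

lemma image_point_works:
  assumes X: "variety emb X" and Y: "variety emb Y" and \<pi>: "proper_birational Y X"
    and P: "P \<in> Y"
  shows "image_point X P \<in> X \<and> dominates P (image_point X P)"
proof -
  have "\<exists>!Q. Q \<in> X \<and> dominates P Q"
  proof (rule ex_ex1I)
    show "\<exists>Q. Q \<in> X \<and> dominates P Q"
      using \<pi> P by (auto simp: proper_birational_def)
    show "Q = Q'" if "Q \<in> X \<and> dominates P Q" "Q' \<in> X \<and> dominates P Q'" for Q Q'
      using X that local_subring_of_variety[OF Y P] by (auto simp: variety_def separated_def)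
  qed
  then show ?thesis unfolding image_point_def by (rule theI')
qed

text \<open>Divided by the local equation at the image of \<open>F\<close>, the section is regular
  there, hence lies in the dominating ring \<open>F\<close>. On \<open>F\<close> the value of
  \<open>ord_at\<close> is a natural number.\<close>

lemma ord_section_nonneg:
  assumes X: "variety emb X" and F: "divisor_over emb X Y F" and s: "s \<in> sections emb X \<omega> k"
  shows "0 \<le> ord_section emb X \<omega> F k s"
proof -
  have "image_point X F \<in> X \<and> dominates F (image_point X F)"
    using image_point_works[OF X] F by (auto simp: divisor_over_def prime_divisors_def)
  then have "pullback_germ emb X \<omega> F k s \<in> F"
    using s by (auto simp: sections_def pullback_germ_def dominates_def)
  then show ?thesis by (simp add: ord_section_def ord_at_def)
qed

section \<open>Half-spaces and barycenters\<close>

text \<open>As an inner product, the first coordinate falls under the general facts on half-spaces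
  and on integrals of linear functionals.\<close>

lemma first_coordinate_inner: "first_coordinate x = axis (Min UNIV) 1 \<bullet> x"
  by (simp add: first_coordinate_def inner_axis')

lemma closure_convex_hull_halfspace_le:
  fixes a :: "'a::real_inner"
  assumes "\<And>x. x \<in> G \<Longrightarrow> a \<bullet> x \<le> b" and "x \<in> closure (convex hull G)"
  shows "a \<bullet> x \<le> b"
proof -
  have "convex hull G \<subseteq> {x. a \<bullet> x \<le> b}"
    using assms(1) by (intro hull_minimal) (auto simp: convex_halfspace_le)
  then have "closure (convex hull G) \<subseteq> {x. a \<bullet> x \<le> b}"
    by (intro closure_minimal closed_halfspace_le)
  then show ?thesis using assms(2) by blast
qed

lemma closure_convex_hull_halfspace_ge:
  fixes a :: "'a::real_inner"
  assumes "\<And>x. x \<in> G \<Longrightarrow> b \<le> a \<bullet> x" and "x \<in> closure (convex hull G)"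
  shows "b \<le> a \<bullet> x"
  using closure_convex_hull_halfspace_le[of G "- a" "- b" x] assms by simp

text \<open>
  If \<open>\<Delta>\<close> has measure \<open>0\<close> or \<open>\<infinity>\<close>, or if the identity is not integrable on it, then the barycenter has
  the junk value \<open>0\<close>.
\<close>

lemma first_coordinate_barycenter:
  fixes \<Delta> :: "(real ^ 'n::{finite,linorder}) set"
  assumes "first_coordinate (barycenter \<Delta>) \<noteq> 0"
  shows "emeasure lborel \<Delta> < \<infinity>" and "0 < measure lborel \<Delta>"
    and "set_integrable lborel \<Delta> first_coordinate"
    and "(LINT x:\<Delta>|lborel. first_coordinate x) =
           first_coordinate (barycenter \<Delta>) * measure lborel \<Delta>"
proof -
  let ?e = "axis (Min UNIV) 1 :: real ^ 'n::{finite,linorder}"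
  have meas: "measure lborel \<Delta> \<noteq> 0"
    using assms by (auto simp: barycenter_def first_coordinate_def)
  then show pos: "0 < measure lborel \<Delta>"
    by (simp add: zero_less_measure_iff)
  \<comment> \<open>A set of infinite \<open>emeasure\<close> has \<open>measure\<close> 0.\<close>
  show "emeasure lborel \<Delta> < \<infinity>"
    using meas by (cases "emeasure lborel \<Delta>") (auto simp: measure_def)
  have "(LINT x:\<Delta>|lborel. x) \<noteq> 0"
    using assms by (auto simp: barycenter_def first_coordinate_def)
  then have int: "integrable lborel (\<lambda>x. indicator \<Delta> x *\<^sub>R x)"
    using not_integrable_integral_eq by (auto simp: set_lebesgue_integral_def)
  have *: "indicator \<Delta> x *\<^sub>R first_coordinate x = ?e \<bullet> (indicator \<Delta> x *\<^sub>R x)" for x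
    by (simp add: first_coordinate_inner)
  show "set_integrable lborel \<Delta> first_coordinate"
    unfolding set_integrable_def * using int by (rule integrable_inner_right)
  have "(LINT x:\<Delta>|lborel. first_coordinate x) = ?e \<bullet> (LINT x:\<Delta>|lborel. x)"
    unfolding set_lebesgue_integral_def * using int by (intro integral_inner_right) simp
  then show "(LINT x:\<Delta>|lborel. first_coordinate x) =
      first_coordinate (barycenter \<Delta>) * measure lborel \<Delta>"
    using meas by (simp add: first_coordinate_inner barycenter_def)
qed

text \<open>The concavity bound for the affine function \<open>M - first_coordinate\<close>. The
  assumption \<open>nz\<close> rules out the default barycenter, which supplies integrability and a
  finite positive measure to divide by.\<close>

lemma barycenter_le:
  fixes \<Delta> :: "(real ^ 'n::{finite,linorder}) set"
  assumes \<Delta>: "closed \<Delta>" "convex \<Delta>" and M: "\<And>x. x \<in> \<Delta> \<Longrightarrow> first_coordinate x \<le> M"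
    and x0: "x0 \<in> \<Delta>" and nz: "first_coordinate (barycenter \<Delta>) \<noteq> 0"
  shows "(real CARD('n) + 1) * first_coordinate (barycenter \<Delta>)
           \<le> real CARD('n) * M + first_coordinate x0"
proof -
  note fin = first_coordinate_barycenter[OF nz]
  let ?m = "measure lborel \<Delta>" and ?b = "first_coordinate (barycenter \<Delta>)"
  have const: "set_integrable lborel \<Delta> (\<lambda>_. M)"
    using fin(1) \<Delta>(1) by (auto simp: set_integrable_def)
  have "(LINT x:\<Delta>|lborel. M - first_coordinate x) = M * ?m - ?b * ?m"
    using fin const \<Delta>(1) by (simp add: set_integral_diff set_integral_const borel_closed)
  moreover have "(M - first_coordinate x0) * ?m
      \<le> (real DIM(real ^ 'n::{finite,linorder}) + 1) * (LINT x:\<Delta>|lborel. M - first_coordinate x)"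
      (is "?l \<le> ?d * ?I")
  proof (rule concave_value_le_integral)
    show "concave_on \<Delta> (\<lambda>x. M - first_coordinate x)"
      unfolding concave_on_iff
    proof (intro conjI ballI allI impI)
      fix x y :: "real ^ 'n::{finite,linorder}" and u v :: real
      assume "u + v = 1"
      then have v: "v = 1 - u" by simp
      then show "u * (M - first_coordinate x) + v * (M - first_coordinate y)
          \<le> M - first_coordinate (u *\<^sub>R x + v *\<^sub>R y)"
        unfolding v by (simp add: first_coordinate_inner inner_add_right algebra_simps)
    qed (rule \<Delta>(2))
  qed (use fin const \<Delta> M x0 in \<open>auto intro: set_integral_diff borel_closed\<close>)
  ultimately have "?l \<le> (real CARD('n) + 1) * (M * ?m - ?b * ?m)"
    by simp
  then have "?l \<le> ((real CARD('n) + 1) * (M - ?b)) * ?m"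
    by (simp add: algebra_simps)
  then have "M - first_coordinate x0 \<le> (real CARD('n) + 1) * (M - ?b)"
    using fin(2) by simp
  then show ?thesis by (simp add: algebra_simps)
qed

section \<open>Okounkov bodies and their generators\<close>

lemma convex_okounkov_body: "convex (okounkov_body emb X \<omega> F fl)"
  unfolding okounkov_body_def by (intro convex_closure convex_convex_hull)

lemma closed_okounkov_body: "closed (okounkov_body emb X \<omega> F fl)"
  unfolding okounkov_body_def by simp

text \<open>The normalized vector \<nu>(s)/k; these are the generators of the Okounkov body.\<close>

definition section_point where
  "section_point emb X \<omega> F fl k s =
     ((1 / real k) *\<^sub>R (\<chi> i. real_of_int (flag_orders emb X \<omega> F fl k s (card {..<i})))
        :: real ^ 'n::{finite,linorder})"

text \<open>The least index has rank 0, and coordinate 0 of \<open>flag_orders\<close> is the order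
  along \<open>F\<close>.\<close>

lemma first_coordinate_section_point:
  "first_coordinate (section_point emb X \<omega> F fl k s :: real ^ 'n::{finite,linorder})
     = real_of_int (ord_section emb X \<omega> F k s) / real k"
proof -
  have "{..<Min (UNIV :: 'n set)} = {}"
    by (auto simp: not_less)
  then show ?thesis
    by (simp add: first_coordinate_def section_point_def flag_orders_def)
qed

lemma okounkov_body_eq:
  "okounkov_body emb X \<omega> F fl = closure (convex hull
     {section_point emb X \<omega> F fl k s | k s.
        canonical_cartier emb X \<omega> k \<and> s \<in> sections emb X \<omega> k - {0}})"
  by (simp add: okounkov_body_def section_point_def)

lemma section_point_mem_okounkov_body:
  "canonical_cartier emb X \<omega> k \<Longrightarrow> s \<in> sections emb X \<omega> k - {0} \<Longrightarrow>
     section_point emb X \<omega> F fl k s \<in> okounkov_body emb X \<omega> F fl"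
  unfolding okounkov_body_eq by (rule subsetD[OF closure_subset], rule hull_inc) blast

section \<open>Invariants of divisorial valuations\<close>

lemma presentation_works:
  assumes "v \<in> Val_div emb X"
  obtains C Y F where "presentation emb X v = (C, Y, F)" "0 < C" "divisor_over emb X Y F"
proof -
  have "case presentation emb X v of (C, Y, F) \<Rightarrow> C > 0 \<and> divisor_over emb X Y F \<and> v = scaled_ord C F"
    unfolding presentation_def by (rule someI_ex) (use assms in \<open>auto simp: Val_div_def\<close>)
  then show ?thesis using that by (cases "presentation emb X v") auto
qed

text \<open>Positivity ensures that a quotient with \<open>S1 = 0\<close> equals \<infinity> and so
  cannot lower \<open>delta\<close>.\<close>

lemma log_discrepancy_pos:
  assumes "klt emb X \<omega>" "v \<in> Val_div emb X"
  shows "0 < log_discrepancy emb X \<omega> v"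
proof (rule presentation_works[OF assms(2)])
  fix C Y F
  assume "presentation emb X v = (C, Y, F)" "0 < C" "divisor_over emb X Y F"
  moreover from this have "- 1 < discrepancy emb X \<omega> F"
    using assms(1) by (auto simp: klt_def)
  ultimately show ?thesis by (simp add: log_discrepancy_def)
qed

text \<open>The generators of the body have nonnegative first coordinate, and the half-space bound
  extends this to the body and to the integral. A barycenter coordinate equal to 0, default value or
  not, is a separate case.\<close>

lemma S1_nonneg:
  fixes \<omega> :: "('n::{finite,linorder} \<Rightarrow> 'a::field \<Rightarrow> 'a) \<Rightarrow> 'a"
  assumes X: "variety emb X" and v: "v \<in> Val_div emb X"
  shows "0 \<le> S1 emb X \<omega> v"
proof (rule presentation_works[OF v])
  fix C Y F
  assume pres: "presentation emb X v = (C, Y, F)" and C: "0 < C" and F: "divisor_over emb X Y F"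
  let ?\<Delta> = "okounkov_body emb X \<omega> F (SOME fl. admissible_flag Y F CARD('n) fl)"
  have "0 \<le> first_coordinate x" if "x \<in> ?\<Delta>" for x
    unfolding first_coordinate_inner
    by (rule closure_convex_hull_halfspace_ge[OF _ that[unfolded okounkov_body_eq]])
      (auto simp: first_coordinate_section_point ord_section_nonneg[OF X F]
        simp flip: first_coordinate_inner)
  then have "0 \<le> (LINT x:?\<Delta>|lborel. first_coordinate x)"
    unfolding set_lebesgue_integral_def
    by (intro Bochner_Integration.integral_nonneg) (simp add: indicator_def)
  then have "0 \<le> first_coordinate (barycenter ?\<Delta>)"
    using first_coordinate_barycenter(2,4)[of ?\<Delta>]
    by (cases "first_coordinate (barycenter ?\<Delta>) = 0") (auto simp: zero_le_mult_iff)
  then show ?thesis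
    using pres C by (simp add: S1_def)
qed

text \<open>Without nonzero sections the body would be empty, of measure 0, with barycenter 0. The
  section found keeps the supremum \<open>S0\<close> and the infimum \<open>sigma_min\<close> from
  running over nothing.\<close>

lemma nonzero_section_if_S1_nonzero:
  fixes \<omega> :: "('n::{finite,linorder} \<Rightarrow> 'a::field \<Rightarrow> 'a) \<Rightarrow> 'a"
  assumes "S1 emb X \<omega> v \<noteq> 0"
  obtains k s where "canonical_cartier emb X \<omega> k" "s \<in> sections emb X \<omega> k - {0}"
proof -
  obtain C Y F where pres: "presentation emb X v = (C, Y, F)"
    by (cases "presentation emb X v") auto
  let ?\<Delta> = "okounkov_body emb X \<omega> F (SOME fl. admissible_flag Y F CARD('n) fl)"
  have "first_coordinate (barycenter ?\<Delta>) \<noteq> 0"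
    using assms pres by (auto simp: S1_def)
  then have "?\<Delta> \<noteq> {}"
    using first_coordinate_barycenter(2)[of ?\<Delta>] by auto
  then show ?thesis
    using that unfolding okounkov_body_eq by auto
qed

text \<open>All generators, hence the whole body, satisfy
  \<open>first_coordinate x \<le> M / C\<close>. Apply \<open>barycenter_le\<close> with
  \<open>x0\<close> the point of the section \<open>s\<close>, then multiply by
  \<open>C\<close>.\<close>

lemma S1_le_S0:
  fixes \<omega> :: "('n::{finite,linorder} \<Rightarrow> 'a::field \<Rightarrow> 'a) \<Rightarrow> 'a"
  assumes v: "v \<in> Val_div emb X" and nz: "S1 emb X \<omega> v \<noteq> 0"
    and S0: "S0 emb X \<omega> v = ereal M"
    and ks: "canonical_cartier emb X \<omega> k" "s \<in> sections emb X \<omega> k - {0}"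
  shows "(real CARD('n) + 1) * S1 emb X \<omega> v
           \<le> real CARD('n) * M + val_section emb X \<omega> v k s / real k"
proof (rule presentation_works[OF v])
  fix C Y F
  assume pres: "presentation emb X v = (C, Y, F)" and C: "0 < C"
  define fl where "fl = (SOME fl. admissible_flag Y F CARD('n) fl)"
  let ?\<Delta> = "okounkov_body emb X \<omega> F fl"
  have S1: "S1 emb X \<omega> v = C * first_coordinate (barycenter ?\<Delta>)"
    using pres by (simp add: S1_def fl_def)
  have val: "val_section emb X \<omega> v k s / real k
      = C * first_coordinate (section_point emb X \<omega> F fl k s :: real ^ 'n::{finite,linorder})" for k s
    using pres by (simp add: val_section_def first_coordinate_section_point)
  have "first_coordinate (section_point emb X \<omega> F fl k s :: real ^ 'n::{finite,linorder}) \<le> M / C"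
    if "canonical_cartier emb X \<omega> k" "s \<in> sections emb X \<omega> k - {0}" for k s
  proof -
    have "ereal (val_section emb X \<omega> v k s / real k) \<le> ereal M"
      unfolding S0[symmetric] S0_def using that by (intro SUP_upper2[of k] SUP_upper) auto
    then show ?thesis
      using C unfolding val by (simp add: field_simps)
  qed
  then have "first_coordinate x \<le> M / C" if "x \<in> ?\<Delta>" for x
    unfolding first_coordinate_inner
    by (intro closure_convex_hull_halfspace_le[OF _ that[unfolded okounkov_body_eq]]) auto
  then have "(real CARD('n) + 1) * first_coordinate (barycenter ?\<Delta>)
      \<le> real CARD('n) * (M / C) + first_coordinate (section_point emb X \<omega> F fl k s :: real ^ 'n::{finite,linorder})"
    using nz S1 section_point_mem_okounkov_body[OF ks]
    by (intro barycenter_le closed_okounkov_body convex_okounkov_body) auto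
  from mult_left_mono[OF this, of C] C show ?thesis
    unfolding val S1 by (simp add: algebra_simps)
qed

text \<open>Take the infimum over all sections in \<open>S1_le_S0\<close>. One nonzero section
  bounds \<open>S0\<close> below and \<open>sigma_min\<close> above; the inequality itself bounds
  \<open>sigma_min\<close> below, so both are real.\<close>

lemma S1_le_S0_sigma_min:
  fixes \<omega> :: "('n::{finite,linorder} \<Rightarrow> 'a::field \<Rightarrow> 'a) \<Rightarrow> 'a"
  assumes X: "variety emb X" and v: "v \<in> Val_div emb X" and nz: "S1 emb X \<omega> v \<noteq> 0"
    and fin: "S0 emb X \<omega> v \<noteq> \<infinity>"
  obtains M m where "S0 emb X \<omega> v = ereal M" "sigma_min emb X \<omega> v = ereal m"
    "(real CARD('n) + 1) * S1 emb X \<omega> v \<le> real CARD('n) * M + m"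
proof -
  obtain k s where ks: "canonical_cartier emb X \<omega> k" "s \<in> sections emb X \<omega> k - {0}"
    using nonzero_section_if_S1_nonzero[OF nz] by blast
  have "ereal (val_section emb X \<omega> v k s / real k) \<le> S0 emb X \<omega> v"
    unfolding S0_def using ks by (intro SUP_upper2[of k] SUP_upper) auto
  with fin obtain M where M: "S0 emb X \<omega> v = ereal M"
    by (cases "S0 emb X \<omega> v") auto
  have "sigma_min emb X \<omega> v \<le> ereal (val_section emb X \<omega> v k s / real k)"
    unfolding sigma_min_def using ks by (intro INF_lower2[of k] INF_lower) auto
  moreover have lower:
    "ereal ((real CARD('n) + 1) * S1 emb X \<omega> v - real CARD('n) * M) \<le> sigma_min emb X \<omega> v"
    unfolding sigma_min_def using S1_le_S0[OF v nz M]
    by (intro INF_greatest) (auto simp: algebra_simps)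
  ultimately obtain m where m: "sigma_min emb X \<omega> v = ereal m"
    by (cases "sigma_min emb X \<omega> v") auto
  show ?thesis
    using lower unfolding m by (intro that[OF M m]) (simp add: algebra_simps)
qed

section \<open>Comparison of the thresholds and conclusion\<close>

text \<open>The estimate is made separately for each valuation. A real \<open>c\<close> in place of
  \<open>alpha_tilde\<close> keeps the arithmetic in the reals.\<close>

lemma delta_ge_of_alpha_tilde_ge:
  fixes \<omega> :: "('n::{finite,linorder} \<Rightarrow> 'a::field \<Rightarrow> 'a) \<Rightarrow> 'a"
  assumes X: "variety emb X" and klt: "klt emb X \<omega>"
    and c: "0 < c" "ereal c \<le> alpha_tilde emb X \<omega>"
  shows "ereal (c * (real CARD('n) + 1) / real CARD('n)) \<le> delta emb X \<omega>"
  unfolding delta_def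
proof (rule INF_greatest)
  fix v assume v: "v \<in> Val_div emb X"
  define A where "A = log_discrepancy emb X \<omega> v"
  define b where "b = S1 emb X \<omega> v"
  let ?n = "real CARD('n)"
  have A: "0 < A" using log_discrepancy_pos[OF klt v] by (simp add: A_def)
  have n: "0 < ?n" by simp
  have le: "ereal c \<le> ereal A / (S0 emb X \<omega> v + sigma_min emb X \<omega> v / ereal ?n)"
    using c(2) unfolding alpha_tilde_def A_def by (rule order_trans) (rule INF_lower[OF v])
  have "ereal (c * (?n + 1) / ?n) \<le> ereal A / ereal b"
  proof (cases "b = 0")
    case True \<comment> \<open>junk barycenters included; division by \<open>0\<close> gives \<open>\<infinity>\<close> in \<open>ereal\<close>\<close>
    then show ?thesis using A by simp
  next
    case False
    then have b: "0 < b" using S1_nonneg[OF X v, of \<omega>] by (simp add: b_def)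
    \<comment> \<open>An infinite \<open>S0\<close> makes the denominator \<infinity>, whatever
      \<open>sigma_min\<close> is, and the quotient 0, contradicting \<open>0 < c\<close>.\<close>
    have "S0 emb X \<omega> v \<noteq> \<infinity>" using le c(1) by auto
    then obtain M m where Mm: "S0 emb X \<omega> v = ereal M" "sigma_min emb X \<omega> v = ereal m"
      and bound: "(?n + 1) * b \<le> ?n * M + m"
      using S1_le_S0_sigma_min[OF X v] False unfolding b_def by metis
    \<comment> \<open>Division by \<open>n\<close> produces the denominator of
      \<open>alpha_tilde\<close>. Since \<open>b > 0\<close> it is positive, so it can be
      cleared.\<close>
    have D: "(?n + 1) * b / ?n \<le> M + m / ?n"
      using divide_right_mono[OF bound, of ?n] n by (simp add: add_divide_distrib)
    then have D_pos: "0 < M + m / ?n"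
      by (rule less_le_trans[rotated]) (use b n in simp)
    have "c \<le> A / (M + m / ?n)"
      using le D_pos n unfolding Mm by simp
    then have "c * (M + m / ?n) \<le> A"
      using D_pos by (simp add: pos_le_divide_eq)
    moreover have "c * ((?n + 1) * b / ?n) \<le> c * (M + m / ?n)"
      using D c(1) by (intro mult_left_mono) auto
    ultimately have "c * (?n + 1) / ?n * b \<le> A"
      by simp
    then show ?thesis
      using b by (simp add: pos_le_divide_eq)
  qed
  then show "ereal (c * (?n + 1) / ?n) \<le> ereal (log_discrepancy emb X \<omega> v) / ereal (S1 emb X \<omega> v)"
    by (simp add: A_def b_def)
qed

theorem theorem1p7:
  fixes emb :: "complex \<Rightarrow> 'a::field"
    and X :: "'a set set"
    and \<omega> :: "('n::{finite,linorder} \<Rightarrow> 'a \<Rightarrow> 'a) \<Rightarrow> 'a"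
  assumes "complex_embedding emb"
    and "projective_variety emb X"
    and "normal_variety X"
    and "krull_dim X = enat CARD('n)"
    and "rational_form emb \<omega>" and "\<omega> \<noteq> (\<lambda>D. 0)"
    and "klt emb X \<omega>"
    and "anticanonical_big emb X \<omega>"
  shows "(alpha_tilde emb X \<omega> > ereal (real CARD('n) / (real CARD('n) + 1)) \<longrightarrow> K_stable emb X \<omega>) \<and>
         (alpha_tilde emb X \<omega> \<ge> ereal (real CARD('n) / (real CARD('n) + 1)) \<longrightarrow> K_semistable emb X \<omega>)"
proof (intro conjI impI)
  let ?n = "real CARD('n)"
  have n: "0 < ?n" by simp
  have X: "variety emb X" using assms(2) by (simp add: projective_variety_def)
  note delta_ge = delta_ge_of_alpha_tilde_ge[OF X assms(7)]
  {
    assume "alpha_tilde emb X \<omega> > ereal (?n / (?n + 1))"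
    \<comment> \<open>A real number strictly between the two sides preserves strictness after
      passing to the infimum \<open>delta\<close>; \<open>alpha_tilde\<close> itself may be
      infinite.\<close>
    then obtain c where c: "?n / (?n + 1) < c" "ereal c < alpha_tilde emb X \<omega>"
      using ereal_dense2 by (metis ereal_less_ereal_Ex less_ereal.simps(1))
    then have "0 < c" using n by (smt (verit) divide_pos_pos)
    moreover have "1 < c * (?n + 1) / ?n"
      using c(1) n by (simp add: field_simps)
    then have "1 < ereal (c * (?n + 1) / ?n)" by simp
    ultimately show "K_stable emb X \<omega>"
      unfolding K_stable_def using delta_ge[of c] c(2) by (meson less_imp_le less_le_trans)
  }
  {
    assume "alpha_tilde emb X \<omega> \<ge> ereal (?n / (?n + 1))"
    \<comment> \<open>At the threshold \<open>c = n / (n + 1)\<close> the lower bound for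
      \<open>delta\<close> is exactly 1.\<close>
    moreover have "?n / (?n + 1) * (?n + 1) / ?n = 1"
      using n by simp
    ultimately have "ereal 1 \<le> delta emb X \<omega>"
      using delta_ge[of "?n / (?n + 1)"] n by simp
    then show "K_semistable emb X \<omega>"
      by (simp only: K_semistable_def one_ereal_def)
  }
qed

end
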